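(* Let $\delta t>0$, $\delta x>0$ and let $\rho_i\in[0,R)$, $i\in\mathbb{Z}$, be a sequence with $M=\sup_{i\in\mathbb{Z}}\rho_i<R$. Let $$\rho_i^+=\rho_i+\frac{\delta t}{\delta x}(G_{i-1}-G_i),\qquad G_i=\rho_i h(-q_i),\qquad q_i=\frac{Q'(\rho_{i+1})-Q'(\rho_i)}{\delta x},\qquad i\in\mathbb{Z}.$$ Suppose that $$1\ge\frac{\delta t}{\delta x}\left(b+2\frac{M\|h'\|_\infty}{\delta x}\max_{0\le\rho\le M}(\kappa(\rho))\right).$$ Then $\rho_i^+\in[0,M]$ for all $i\in\mathbb{Z}$.
   Context: Constants: $R>1$, $b>0$. The function $\kappa\in C^1([0,R);[0,+\infty))$ satisfies $\kappa(\rho)=0$ for $\rho\in[0,1]$ and $\kappa(\rho)>0$ for $\rho\in(1,R)$. The function $h\in C^1(\mathbb{R};(-1,b))$ satisfies $h'\in L^\infty(\mathbb{R})$, $h(0)=0$, $h'(s)>0$ for all $s\in\mathbb{R}$, and is onto $(-1,b)$. Define $Q(\rho)=\int_1^\rho(\rho-\tau)\kappa(\tau)\,d\tau$ for $\rho\in[0,R)$, so $Q'(\rho)=\int_1^\rho\kappa(\tau)\,d\tau$. $\|h'\|_\infty$ is the supremum norm of $h'$ on $\mathbb{R}$. *)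

theory Defs
  imports "HOL-Analysis.Analysis"
begin

text \<open>Continuous differentiability relative to \<open>S\<close>. Derivatives are taken within \<open>S\<close>, so they
  are one-sided at an endpoint belonging to \<open>S\<close>; the library's \<open>C1_differentiable_on\<close> takes
  two-sided derivatives and would constrain \<open>f\<close> outside \<open>S\<close>.\<close>

definition C1_on :: "real set \<Rightarrow> (real \<Rightarrow> real) \<Rightarrow> bool" where
  "C1_on S f \<longleftrightarrow>
     (\<exists>f'. (\<forall>x\<in>S. (f has_real_derivative f' x) (at x within S)) \<and> continuous_on S f')"

text \<open>The interval integral is oriented, which matters for \<open>\<rho> < 1\<close>.\<close>

definition Qfun :: "(real \<Rightarrow> real) \<Rightarrow> real \<Rightarrow> real" where
  "Qfun \<kappa> \<rho> = (LBINT \<tau>=1..\<rho>. (\<rho> - \<tau>) * \<kappa> \<tau>)"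

text \<open>The derivative of \<open>Q\<close> on its domain \<open>[0,R)\<close>, one-sided at \<open>0\<close>. By \<open>Qderiv_eq\<close> below it is
  the integral of \<open>\<kappa>\<close> from \<open>1\<close>.\<close>

definition Qderiv :: "real \<Rightarrow> (real \<Rightarrow> real) \<Rightarrow> real \<Rightarrow> real" where
  "Qderiv R \<kappa> \<rho> = vector_derivative (Qfun \<kappa>) (at \<rho> within {0..<R})"

definition qdiff :: "real \<Rightarrow> (real \<Rightarrow> real) \<Rightarrow> real \<Rightarrow> (int \<Rightarrow> real) \<Rightarrow> int \<Rightarrow> real" where
  "qdiff R \<kappa> \<delta>x \<rho> i = (Qderiv R \<kappa> (\<rho> (i + 1)) - Qderiv R \<kappa> (\<rho> i)) / \<delta>x"

definition flux ::
    "real \<Rightarrow> (real \<Rightarrow> real) \<Rightarrow> (real \<Rightarrow> real) \<Rightarrow> real \<Rightarrow> (int \<Rightarrow> real) \<Rightarrow> int \<Rightarrow> real" where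
  "flux R \<kappa> h \<delta>x \<rho> i = \<rho> i * h (- qdiff R \<kappa> \<delta>x \<rho> i)"

definition scheme_step ::
    "real \<Rightarrow> (real \<Rightarrow> real) \<Rightarrow> (real \<Rightarrow> real) \<Rightarrow> real \<Rightarrow> real \<Rightarrow> (int \<Rightarrow> real) \<Rightarrow> int \<Rightarrow> real" where
  "scheme_step R \<kappa> h \<delta>t \<delta>x \<rho> i =
     \<rho> i + \<delta>t / \<delta>x * (flux R \<kappa> h \<delta>x \<rho> (i - 1) - flux R \<kappa> h \<delta>x \<rho> i)"

text \<open>Supremum norm; meaningful for bounded \<open>f\<close> only.\<close>

definition sup_norm :: "(real \<Rightarrow> real) \<Rightarrow> real" where
  "sup_norm f = (SUP s. \<bar>f s\<bar>)"

lemma Qderiv_eq: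
  assumes R: "R > 1" and cont: "continuous_on {0..<R} \<kappa>" and \<rho>: "\<rho> \<in> {0..<R}"
  shows "Qderiv R \<kappa> \<rho> = (LBINT \<tau>=1..\<rho>. \<kappa> \<tau>)"
proof -
  obtain c where c: "max \<rho> 1 < c" "c < R"
    using R \<rho> dense[of "max \<rho> 1" R] by auto
  have cont_c: "continuous_on {0..c} \<kappa>"
    using cont by (rule continuous_on_subset) (use c in auto)
  have cont_c': "continuous_on {0..c} (\<lambda>\<tau>. \<tau> * \<kappa> \<tau>)"
    by (intro continuous_intros cont_c)
  have at: "at \<rho> within {0..<R} = at \<rho> within {0..c}"
    by (rule at_within_nhd[of _ "{..<c}"]) (use c \<rho> in auto)
  define A where "A = (\<lambda>u::real. LBINT \<tau>=1..u. \<kappa> \<tau>)"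
  define B where "B = (\<lambda>u::real. LBINT \<tau>=1..u. \<tau> * \<kappa> \<tau>)"
  have dA: "(A has_vector_derivative \<kappa> \<rho>) (at \<rho> within {0..c})"
    unfolding A_def one_ereal_def
    by (rule interval_integral_FTC2) (use c \<rho> cont_c in auto)
  have dB: "(B has_vector_derivative \<rho> * \<kappa> \<rho>) (at \<rho> within {0..c})"
    unfolding B_def one_ereal_def
    by (rule interval_integral_FTC2[where f="\<lambda>\<tau>. \<tau> * \<kappa> \<tau>"]) (use c \<rho> cont_c' in auto)
  have split: "Qfun \<kappa> u = u * A u - B u" if u: "u \<in> {0..c}" for u
  proof -
    have sub: "{min 1 u..max 1 u} \<subseteq> {0..c}" using u c by auto
    have integrable: "interval_lebesgue_integrable lborel (ereal 1) (ereal u) f"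
      if f: "continuous_on {0..c} f" for f :: "real \<Rightarrow> real"
    proof (cases "1 \<le> u")
      case True
      then show ?thesis
        using continuous_on_subset[OF f sub] by (intro interval_integrable_continuous_on) auto
    next
      case False
      then show ?thesis
        using continuous_on_subset[OF f sub]
        by (subst interval_integrable_endpoints_reverse, intro interval_integrable_continuous_on) auto
    qed
    have i1: "interval_lebesgue_integrable lborel (ereal 1) (ereal u) (\<lambda>\<tau>. u * \<kappa> \<tau>)"
      by (intro integrable continuous_intros cont_c)
    have i2: "interval_lebesgue_integrable lborel (ereal 1) (ereal u) (\<lambda>\<tau>. \<tau> * \<kappa> \<tau>)"
      by (intro integrable cont_c')
    have "Qfun \<kappa> u = (LBINT \<tau>=ereal 1..ereal u. u * \<kappa> \<tau> - \<tau> * \<kappa> \<tau>)"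
      by (simp add: Qfun_def one_ereal_def left_diff_distrib)
    also have "\<dots> = u * A u - B u"
      using interval_lebesgue_integral_diff(2)[OF i1 i2]
      by (simp add: A_def B_def one_ereal_def)
    finally show ?thesis .
  qed
  have "((\<lambda>u. u * A u - B u) has_vector_derivative A \<rho>) (at \<rho> within {0..c})"
    using dA dB unfolding has_real_derivative_iff_has_vector_derivative[symmetric]
    by (auto intro!: derivative_eq_intros)
  then have "(Qfun \<kappa> has_vector_derivative A \<rho>) (at \<rho> within {0..c})"
    by (rule has_vector_derivative_transform[rotated 2]) (use c \<rho> split in auto)
  then have "(Qfun \<kappa> has_vector_derivative A \<rho>) (at \<rho> within {0..<R})"
    by (simp add: at)
  moreover have "at \<rho> within {0..<R} \<noteq> bot"
    unfolding at using c \<rho> by (simp add: trivial_limit_within)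
  ultimately show ?thesis
    by (simp add: Qderiv_def A_def vector_derivative_within)
qed

end

theory Submission
  imports Defs
begin

text \<open>The interface velocity \<open>h (- q\<^sub>i)\<close> is never of the sign opposite to \<open>\<rho>\<^sub>i - \<rho>\<^sub>i\<^sub>+\<^sub>1\<close>
  and is at most \<open>c \<bar>\<rho>\<^sub>i - \<rho>\<^sub>i\<^sub>+\<^sub>1\<bar>\<close> in size, where \<open>c = \<parallel>h'\<parallel> (max \<kappa>) / \<delta>x\<close>: both \<open>h\<close> and
  \<open>Q'\<close> are nondecreasing and Lipschitz (\<open>Q'\<close> on \<open>[0, M]\<close>), and \<open>h\<close> vanishes at \<open>0\<close>. Hence a
  cell loses mass through its left interface only when the left neighbour is lower, and then at
  a rate of at most \<open>M c \<rho>\<^sub>i\<close>; through its right interface it loses at most \<open>b \<rho>\<^sub>i\<close>. All losses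
  are thus proportional to the content \<open>\<rho>\<^sub>i\<close>, and the restriction on \<open>\<delta>t\<close> keeps their sum at
  most \<open>\<rho>\<^sub>i\<close>. Symmetrically, mass enters only from a neighbour that is higher, so each of the two
  gains is at most \<open>M c (M - \<rho>\<^sub>i)\<close>, proportional to the room that is left in the cell, and again
  the restriction keeps their sum within that room.

  The lemma \<open>increment_bounds\<close> supplies the one-sided Lipschitz estimates, and
  \<open>upwind_step_in_interval\<close> is the balance of gains and losses.\<close>

text \<open>The terms with \<open>min\<close> and \<open>max\<close> record monotonicity and the Lipschitz bound at once: the
  bound on the side of the wrong sign is \<open>0\<close>. In this form the estimates for \<open>Q'\<close> and for \<open>h\<close>
  compose.\<close>

lemma increment_bounds:
  fixes f :: "real \<Rightarrow> real"
  assumes deriv: "\<And>z. z \<in> {a..b} \<Longrightarrow> (f has_real_derivative f' z) (at z within {a..b})"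
    and bounds: "\<And>z. z \<in> {a..b} \<Longrightarrow> 0 \<le> f' z \<and> f' z \<le> C"
    and x: "x \<in> {a..b}" and y: "y \<in> {a..b}"
  shows "C * min 0 (x - y) \<le> f x - f y" and "f x - f y \<le> C * max 0 (x - y)"
proof -
  have ordered: "0 \<le> f v - f u \<and> f v - f u \<le> C * (v - u)"
    if "u \<in> {a..b}" "v \<in> {a..b}" "u \<le> v" for u v
  proof (cases "u = v")
    case False
    then have "u < v" using that by simp
    moreover have "(f has_derivative (*) (f' z)) (at z within {u..v})"
      if "u \<le> z" "z \<le> v" for z
      using DERIV_subset[OF deriv[of z], of "{u..v}"] that \<open>u \<in> {a..b}\<close> \<open>v \<in> {a..b}\<close>
      by (simp add: has_field_derivative_def)
    ultimately obtain z where z: "z \<in> {u<..<v}" "f v - f u = f' z * (v - u)"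
      using mvt_simple[of u v f "\<lambda>z. (*) (f' z)"] by auto
    have "0 \<le> f' z" "f' z \<le> C" using bounds[of z] z(1) that by auto
    then show ?thesis using z(2) \<open>u \<le> v\<close> by (simp add: mult_right_mono)
  qed simp
  show "C * min 0 (x - y) \<le> f x - f y" "f x - f y \<le> C * max 0 (x - y)"
    using ordered[OF x y] ordered[OF y x] by (auto simp: min_def max_def algebra_simps)
qed

lemma has_real_derivative_Qderiv:
  assumes R: "R > 1" and cont: "continuous_on {0..<R} \<kappa>" and c: "1 \<le> c" "c < R"
    and x: "x \<in> {0..c}"
  shows "(Qderiv R \<kappa> has_real_derivative \<kappa> x) (at x within {0..c})"
proof -
  have "continuous_on {0..c} \<kappa>"
    using cont by (rule continuous_on_subset) (use c in auto)
  then have "((\<lambda>u::real. LBINT \<tau>=1..u. \<kappa> \<tau>) has_vector_derivative \<kappa> x) (at x within {0..c})"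
    unfolding one_ereal_def by (intro interval_integral_FTC2) (use c x in auto)
  then have "(Qderiv R \<kappa> has_vector_derivative \<kappa> x) (at x within {0..c})"
    by (rule has_vector_derivative_transform[rotated 2]) (use c x Qderiv_eq[OF R cont] in auto)
  then show ?thesis
    by (simp add: has_real_derivative_iff_has_vector_derivative)
qed

text \<open>Here \<open>l\<close>, \<open>m\<close>, \<open>r\<close> are the contents of three adjacent cells, and \<open>u\<close>, \<open>v\<close> the velocities at
  the left and right interface of the middle one. Nonnegativity needs \<open>\<mu> (b + M c) \<le> 1\<close>,
  for outflow to the right and backflow to the left; the bound by \<open>M\<close> needs \<open>\<mu> (2 M c) \<le> 1\<close>, for
  inflow from both sides. The hypothesis implies both.\<close>

lemma upwind_step_in_interval:
  fixes l m r u v b c M \<mu> :: real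
  assumes l: "l \<in> {0..M}" and m: "m \<in> {0..M}" and r: "r \<in> {0..M}"
    and "0 \<le> b" "0 \<le> c" "0 \<le> \<mu>"
    and u: "c * min 0 (l - m) \<le> u" "u \<le> c * max 0 (l - m)"
    and v: "c * min 0 (m - r) \<le> v" "v \<le> b"
    and cfl: "\<mu> * (b + 2 * (M * c)) \<le> 1"
  shows "m + \<mu> * (l * u - m * v) \<in> {0..M}"
proof -
  have "0 \<le> M" using m by simp
  then have "0 \<le> M * c" using \<open>0 \<le> c\<close> by simp
  have "0 \<le> m + \<mu> * (l * u - m * v)"
  proof -
    have "c * (- m) \<le> c * min 0 (l - m)"
      using l m \<open>0 \<le> c\<close> by (intro mult_left_mono) auto
    then have "- (c * m) \<le> u" using u(1) by simp
    then have "l * (- (c * m)) \<le> l * u" using l by (intro mult_left_mono) auto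
    moreover have "l * (c * m) \<le> M * (c * m)"
      using l m \<open>0 \<le> c\<close> by (intro mult_right_mono) auto
    moreover have "m * v \<le> m * b" using m v(2) by (intro mult_left_mono) auto
    ultimately have "- (m * (b + M * c)) \<le> l * u - m * v" by (simp add: algebra_simps)
    then have "\<mu> * (- (m * (b + M * c))) \<le> \<mu> * (l * u - m * v)"
      using \<open>0 \<le> \<mu>\<close> by (rule mult_left_mono)
    moreover have "m * (\<mu> * (b + M * c)) \<le> m * 1"
    proof (rule mult_left_mono)
      have "\<mu> * (b + M * c) \<le> \<mu> * (b + 2 * (M * c))"
        using \<open>0 \<le> \<mu>\<close> \<open>0 \<le> M * c\<close> by (intro mult_left_mono) auto
      then show "\<mu> * (b + M * c) \<le> 1" using cfl by linarith
    qed (use m in simp)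
    ultimately show ?thesis by (simp add: algebra_simps)
  qed
  moreover have "m + \<mu> * (l * u - m * v) \<le> M"
  proof -
    have "c * max 0 (l - m) \<le> c * (M - m)" "c * (- (M - m)) \<le> c * min 0 (m - r)"
      using l m r \<open>0 \<le> c\<close> by (auto intro!: mult_left_mono)
    then have u': "u \<le> c * (M - m)" and v': "- (c * (M - m)) \<le> v" using u(2) v(1) by linarith+
    have room: "0 \<le> c * (M - m)" using m \<open>0 \<le> c\<close> by simp
    have "l * u \<le> l * (c * (M - m))" using u' l by (intro mult_left_mono) auto
    also have "\<dots> \<le> M * (c * (M - m))" using l room by (intro mult_right_mono) auto
    finally have gain_left: "l * u \<le> M * (c * (M - m))" .
    have "m * (- v) \<le> m * (c * (M - m))" using v' m by (intro mult_left_mono) auto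
    also have "\<dots> \<le> M * (c * (M - m))" using m room by (intro mult_right_mono) auto
    finally have "l * u - m * v \<le> (M - m) * (2 * (M * c))"
      using gain_left by (simp add: algebra_simps)
    then have "\<mu> * (l * u - m * v) \<le> \<mu> * ((M - m) * (2 * (M * c)))"
      using \<open>0 \<le> \<mu>\<close> by (rule mult_left_mono)
    moreover have "(M - m) * (\<mu> * (2 * (M * c))) \<le> (M - m) * 1"
    proof (rule mult_left_mono)
      have "\<mu> * (2 * (M * c)) \<le> \<mu> * (b + 2 * (M * c))"
        using \<open>0 \<le> \<mu>\<close> \<open>0 \<le> b\<close> by (intro mult_left_mono) auto
      then show "\<mu> * (2 * (M * c)) \<le> 1" using cfl by linarith
    qed (use m in simp)
    ultimately show ?thesis by (simp add: algebra_simps)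
  qed
  ultimately show ?thesis by simp
qed

lemma abs_le_sup_norm:
  assumes "bounded (range f)"
  shows "\<bar>f s\<bar> \<le> sup_norm f"
  unfolding sup_norm_def
proof (rule cSUP_upper)
  show "bdd_above (range (\<lambda>s. \<bar>f s\<bar>))"
    using assms unfolding bounded_iff bdd_above_def by auto
qed simp

lemma C1_on_imp_continuous_on: "C1_on S f \<Longrightarrow> continuous_on S f"
  unfolding C1_on_def by (blast intro: DERIV_continuous_on)

lemma C1_on_UNIV_has_deriv:
  assumes "C1_on UNIV f"
  shows "(f has_real_derivative deriv f s) (at s)"
  using assms unfolding C1_on_def by (metis DERIV_imp_deriv UNIV_I)

theorem proposition4:
  fixes R b :: real and \<kappa> h :: "real \<Rightarrow> real"
    and \<delta>t \<delta>x M :: real and \<rho> :: "int \<Rightarrow> real"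
  assumes "R > 1" and "b > 0"
    and "C1_on {0..<R} \<kappa>" and "\<kappa> ` {0..<R} \<subseteq> {0..}"
    and "\<And>r. r \<in> {0..1} \<Longrightarrow> \<kappa> r = 0"
    and "\<And>r. r \<in> {1<..<R} \<Longrightarrow> \<kappa> r > 0"
    and "C1_on UNIV h" and "range h = {-1<..<b}"
    and "bounded (range (deriv h))" and "h 0 = 0" and "\<And>s. deriv h s > 0"
    and "\<delta>t > 0" and "\<delta>x > 0"
    and "\<And>i. \<rho> i \<in> {0..<R}"
    and "M = (SUP i. \<rho> i)" and "M < R"
    and "1 \<ge> \<delta>t / \<delta>x * (b + 2 * (M * sup_norm (deriv h) / \<delta>x) * (SUP r\<in>{0..M}. \<kappa> r))"
  shows "\<forall>i. scheme_step R \<kappa> h \<delta>t \<delta>x \<rho> i \<in> {0..M}"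
proof
  fix i
  define K where "K = (SUP r\<in>{0..M}. \<kappa> r)"
  define L where "L = sup_norm (deriv h)"
  have \<kappa>_cont: "continuous_on {0..<R} \<kappa>" using assms(3) by (rule C1_on_imp_continuous_on)
  have \<rho>_bounds: "\<rho> j \<in> {0..M}" for j
  proof -
    have "bdd_above (range \<rho>)"
      using assms(14) by (intro bdd_aboveI[of _ R]) (auto intro: less_imp_le)
    then have "\<rho> j \<le> M" unfolding assms(15) by (intro cSUP_upper) auto
    then show ?thesis using assms(14)[of j] by simp
  qed
  have \<kappa>_bounds: "0 \<le> \<kappa> z \<and> \<kappa> z \<le> K" if z: "z \<in> {0..M}" for z
  proof
    show "0 \<le> \<kappa> z" using assms(4) z \<open>M < R\<close> by (auto simp: image_subset_iff)
    have "continuous_on {0..M} \<kappa>"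
      using \<kappa>_cont by (rule continuous_on_subset) (use \<open>M < R\<close> in auto)
    then have "bdd_above (\<kappa> ` {0..M})"
      by (intro bounded_imp_bdd_above compact_imp_bounded compact_continuous_image) auto
    then show "\<kappa> z \<le> K" unfolding K_def using z by (rule cSUP_upper[rotated])
  qed
  have K: "0 \<le> K" using \<kappa>_bounds[OF \<rho>_bounds] by fastforce
  have deriv_h_bounds: "0 \<le> deriv h s \<and> deriv h s \<le> L" for s
    using assms(11)[of s] abs_le_sup_norm[OF assms(9), of s] by (simp add: L_def)
  then have L: "0 \<le> L" by (meson order_trans)
  have P_deriv: "(Qderiv R \<kappa> has_real_derivative \<kappa> z) (at z within {0..M})"
    if "z \<in> {0..M}" for z
    \<comment> \<open>\<open>M\<close> may lie below \<open>1\<close>, the base point of the integral that defines \<open>Q'\<close>.\<close>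
    by (rule DERIV_subset[OF has_real_derivative_Qderiv[OF assms(1) \<kappa>_cont, of "max M 1"]])
      (use assms(1) \<open>M < R\<close> that in auto)
  have h_bounds: "L * min 0 s \<le> h s" "h s \<le> L * max 0 s" for s
    using increment_bounds[of "min 0 s" "max 0 s" h "deriv h" L s 0] \<open>h 0 = 0\<close> deriv_h_bounds
      has_field_derivative_at_within[OF C1_on_UNIV_has_deriv[OF assms(7)]]
    by auto
  define c where "c = L * K / \<delta>x"
  have c: "0 \<le> c" using K L \<open>\<delta>x > 0\<close> by (simp add: c_def)
  have velocity: "c * min 0 (\<rho> j - \<rho> (j + 1)) \<le> h (- qdiff R \<kappa> \<delta>x \<rho> j)"
    "h (- qdiff R \<kappa> \<delta>x \<rho> j) \<le> c * max 0 (\<rho> j - \<rho> (j + 1))" for j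
  proof -
    let ?x = "\<rho> j" and ?y = "\<rho> (j + 1)" and ?s = "- qdiff R \<kappa> \<delta>x \<rho> j"
    have s: "?s = (Qderiv R \<kappa> ?x - Qderiv R \<kappa> ?y) / \<delta>x"
      by (simp add: qdiff_def minus_divide_left)
    note P = increment_bounds[OF P_deriv \<kappa>_bounds \<rho>_bounds[of j] \<rho>_bounds[of "j + 1"]]
    have "K * min 0 (?x - ?y) / \<delta>x \<le> ?s" "?s \<le> K * max 0 (?x - ?y) / \<delta>x"
      unfolding s using P \<open>\<delta>x > 0\<close> by (simp_all add: divide_right_mono)
    moreover have "K * min 0 (?x - ?y) / \<delta>x \<le> 0" "0 \<le> K * max 0 (?x - ?y) / \<delta>x"
      using K \<open>\<delta>x > 0\<close> by (simp_all add: divide_le_0_iff mult_nonneg_nonpos)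
    ultimately have "L * (K * min 0 (?x - ?y) / \<delta>x) \<le> L * min 0 ?s"
      "L * max 0 ?s \<le> L * (K * max 0 (?x - ?y) / \<delta>x)"
      using L by (intro mult_left_mono; simp only: min.bounded_iff max.bounded_iff)+
    then show "c * min 0 (?x - ?y) \<le> h ?s" "h ?s \<le> c * max 0 (?x - ?y)"
      using h_bounds[of ?s] by (simp_all add: c_def mult.assoc)
  qed
  have "h s \<le> b" for s using assms(8) by (metis greaterThanLessThan_iff less_imp_le rangeI)
  moreover have "\<delta>t / \<delta>x * (b + 2 * (M * c)) \<le> 1"
    using assms(17) by (simp add: c_def K_def L_def mult.assoc)
  ultimately show "scheme_step R \<kappa> h \<delta>t \<delta>x \<rho> i \<in> {0..M}"
    unfolding scheme_step_def flux_def
    using velocity[of "i - 1"] velocity(1)[of i] c assms(2,12,13)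
    by (intro upwind_step_in_interval[OF \<rho>_bounds \<rho>_bounds \<rho>_bounds[of "i + 1"]]) auto
qed

end
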